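(* Let $X$ be a vector lattice and suppose that $\sigma$-order convergence and uniform convergence agree on sequences in $X$. Then $\sigma$-order convergence and uniform convergence also agree on nets in the uniform completion $X^{\mathrm{ru}}$. Furthermore, the uniform adherence $\overline{X}^{1}$ of $X$ in $X^\delta$ equals the uniform closure $\overline{X}$ of $X$ in $X^\delta$, and $\overline{X}$ is the intersection of all sublattices of $X^\delta$ which contain $X$ and are complete under $\sigma$-order convergence.
   Context: All vector lattices are real and Archimedean. In a vector lattice $V$, a net $(x_\alpha)$ converges (relatively) uniformly to $x\in V$ if there is $e\in V_+$ such that for every $\varepsilon>0$ there is $\alpha_0$ with $|x_\alpha-x|\le\varepsilon e$ for all $\alpha\ge\alpha_0$. A net $(x_\alpha)$ in $V$ $\sigma$-order converges to $x\in V$ if there is a sequence $(z_n)$ in $V$ with $z_n\downarrow 0$ such that for every $n$ there is $\alpha_0$ with $|x_\alpha-x|\le z_n$ whenever $\alpha\ge\alpha_0$. A net $(x_\alpha)_{\alpha\in\Lambda}$ is uniformly (respectively, $\sigma$-order) Cauchy in $V$ if the net $(x_\alpha-x_\beta)$ indexed by $\Lambda^2$ converges to $0$ uniformly (respectively, in $\sigma$-order) in $V$. $V$ is uniformly complete (respectively, complete under $\sigma$-order convergence) if every uniformly (respectively, $\sigma$-order) Cauchy net in $V$ converges uniformly (respectively, in $\sigma$-order) in $V$; for a sublattice this is understood in the sublattice as a vector lattice in its own right. $X^\delta$ denotes the order (Dedekind) completion of $X$. The uniform completion $X^{\mathrm{ru}}$ is the intersection of all uniformly complete sublattices of $X^\delta$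 containing $X$. The uniform adherence of a subset $A$ of $V$ in $V$ is the set of all limits in $V$ of nets in $A$ converging uniformly in $V$; $A$ is uniformly closed if it equals its adherence; the uniform closure of $A$ in $V$ is the intersection of all uniformly closed subsets of $V$ containing $A$. *)

theory Defs
  imports Complex_Main "HOL-Library.Lattice_Algebras" "HOL-Library.FuncSet"
begin

class vector_lattice = ordered_real_vector + lattice_ab_group_add_abs

class archimedean_vector_lattice = vector_lattice +
  assumes archimedean: "0 \<le> x \<Longrightarrow> (\<And>n::nat. real n *\<^sub>R x \<le> y) \<Longrightarrow> x = 0"

class dedekind_complete_vector_lattice = vector_lattice + conditionally_complete_lattice

text \<open>Sublattices are linear sublattices.  (Closure under \<^term>\<open>inf\<close> follows from
  \<open>inf x y = - sup (- x) (- y)\<close>.)\<close>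

definition sublattice :: "'v::vector_lattice set \<Rightarrow> bool" where
  "sublattice S \<longleftrightarrow> subspace S \<and> (\<forall>x\<in>S. \<forall>y\<in>S. sup x y \<in> S)"


subsection \<open>Nets\<close>

definition directed_set :: "'i set \<Rightarrow> ('i \<Rightarrow> 'i \<Rightarrow> bool) \<Rightarrow> bool" where
  "directed_set \<Lambda> le \<longleftrightarrow> \<Lambda> \<noteq> {} \<and> reflp_on \<Lambda> le \<and> transp_on \<Lambda> le \<and>
     (\<forall>\<alpha>\<in>\<Lambda>. \<forall>\<beta>\<in>\<Lambda>. \<exists>\<gamma>\<in>\<Lambda>. le \<alpha> \<gamma> \<and> le \<beta> \<gamma>)"

definition net_in :: "'v set \<Rightarrow> 'i set \<Rightarrow> ('i \<Rightarrow> 'i \<Rightarrow> bool) \<Rightarrow> ('i \<Rightarrow> 'v) \<Rightarrow> bool" where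
  "net_in V \<Lambda> le x \<longleftrightarrow> directed_set \<Lambda> le \<and> x \<in> \<Lambda> \<rightarrow> V"

text \<open>The set \<open>V\<close> below is the carrier of the vector lattice in which convergence takes place: the
  whole type or a sublattice of it.  Regulators and dominating sequences are taken in \<open>V\<close>, and
  infima are computed in \<open>V\<close>.\<close>

definition uniform_conv ::
  "'v::vector_lattice set \<Rightarrow> 'i set \<Rightarrow> ('i \<Rightarrow> 'i \<Rightarrow> bool) \<Rightarrow> ('i \<Rightarrow> 'v) \<Rightarrow> 'v \<Rightarrow> bool" where
  "uniform_conv V \<Lambda> le x l \<longleftrightarrow>
     (\<exists>e\<in>V. 0 \<le> e \<and> (\<forall>\<epsilon>::real. \<epsilon> > 0 \<longrightarrow>
        (\<exists>\<alpha>0\<in>\<Lambda>. \<forall>\<alpha>\<in>\<Lambda>. le \<alpha>0 \<alpha> \<longrightarrow> \<bar>x \<alpha> - l\<bar> \<le> \<epsilon> *\<^sub>R e)))"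

definition decreases_to_zero :: "'v::vector_lattice set \<Rightarrow> (nat \<Rightarrow> 'v) \<Rightarrow> bool" where
  "decreases_to_zero V z \<longleftrightarrow> range z \<subseteq> V \<and> antimono z \<and>
     (\<forall>n. 0 \<le> z n) \<and> (\<forall>v\<in>V. (\<forall>n. v \<le> z n) \<longrightarrow> v \<le> 0)"

definition sigma_order_conv ::
  "'v::vector_lattice set \<Rightarrow> 'i set \<Rightarrow> ('i \<Rightarrow> 'i \<Rightarrow> bool) \<Rightarrow> ('i \<Rightarrow> 'v) \<Rightarrow> 'v \<Rightarrow> bool" where
  "sigma_order_conv V \<Lambda> le x l \<longleftrightarrow>
     (\<exists>z. decreases_to_zero V z \<and>
        (\<forall>n. \<exists>\<alpha>0\<in>\<Lambda>. \<forall>\<alpha>\<in>\<Lambda>. le \<alpha>0 \<alpha> \<longrightarrow> \<bar>x \<alpha> - l\<bar> \<le> z n))"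

definition convergences_agree ::
  "'v::vector_lattice set \<Rightarrow> 'i set \<Rightarrow> ('i \<Rightarrow> 'i \<Rightarrow> bool) \<Rightarrow> bool" where
  "convergences_agree V \<Lambda> le \<longleftrightarrow>
     (\<forall>x\<in>\<Lambda> \<rightarrow> V. \<forall>l\<in>V. sigma_order_conv V \<Lambda> le x l \<longleftrightarrow> uniform_conv V \<Lambda> le x l)"

definition uniformly_cauchy ::
  "'v::vector_lattice set \<Rightarrow> 'i set \<Rightarrow> ('i \<Rightarrow> 'i \<Rightarrow> bool) \<Rightarrow> ('i \<Rightarrow> 'v) \<Rightarrow> bool" where
  "uniformly_cauchy V \<Lambda> le x \<longleftrightarrow>
     uniform_conv V (\<Lambda> \<times> \<Lambda>) (rel_prod le le) (\<lambda>(\<alpha>, \<beta>). x \<alpha> - x \<beta>) 0"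

definition sigma_order_cauchy ::
  "'v::vector_lattice set \<Rightarrow> 'i set \<Rightarrow> ('i \<Rightarrow> 'i \<Rightarrow> bool) \<Rightarrow> ('i \<Rightarrow> 'v) \<Rightarrow> bool" where
  "sigma_order_cauchy V \<Lambda> le x \<longleftrightarrow>
     sigma_order_conv V (\<Lambda> \<times> \<Lambda>) (rel_prod le le) (\<lambda>(\<alpha>, \<beta>). x \<alpha> - x \<beta>) 0"


subsection \<open>Completeness, adherence and closure\<close>

text \<open>A definition cannot quantify over all index types.  Every net in \<open>'v\<close> has the same tails as
  a net indexed by pairs \<open>(A, a)\<close> with \<open>a \<in> A\<close> and \<open>A\<close> containing a tail, ordered by reverse
  inclusion of the first components.  So the index type \<open>'v set \<times> 'v\<close> suffices; the lemmas
  \<open>uniformly_completeD\<close>, \<open>sigma_order_completeD\<close> and \<open>uniform_adherenceI\<close> below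
  confirm this for arbitrary index types.\<close>

type_synonym 'v net_index = "'v set \<times> 'v"

definition uniformly_complete :: "'v::vector_lattice set \<Rightarrow> bool" where
  "uniformly_complete V \<longleftrightarrow>
     (\<forall>(\<Lambda> :: 'v net_index set) le x. net_in V \<Lambda> le x \<longrightarrow> uniformly_cauchy V \<Lambda> le x \<longrightarrow>
        (\<exists>l\<in>V. uniform_conv V \<Lambda> le x l))"

definition sigma_order_complete :: "'v::vector_lattice set \<Rightarrow> bool" where
  "sigma_order_complete V \<longleftrightarrow>
     (\<forall>(\<Lambda> :: 'v net_index set) le x. net_in V \<Lambda> le x \<longrightarrow> sigma_order_cauchy V \<Lambda> le x \<longrightarrow>
        (\<exists>l\<in>V. sigma_order_conv V \<Lambda> le x l))"

definition uniform_adherence :: "'v::vector_lattice set \<Rightarrow> 'v set \<Rightarrow> 'v set" where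
  "uniform_adherence V A =
     {l\<in>V. \<exists>(\<Lambda> :: 'v net_index set) le x. net_in A \<Lambda> le x \<and> uniform_conv V \<Lambda> le x l}"

definition uniformly_closed :: "'v::vector_lattice set \<Rightarrow> 'v set \<Rightarrow> bool" where
  "uniformly_closed V A \<longleftrightarrow> A \<subseteq> V \<and> uniform_adherence V A = A"

definition uniform_closure :: "'v::vector_lattice set \<Rightarrow> 'v set \<Rightarrow> 'v set" where
  "uniform_closure V A = \<Inter>{C. uniformly_closed V C \<and> A \<subseteq> C}"


subsection \<open>Order completion and uniform completion\<close>

text \<open>\<open>\<iota>\<close> exhibits its codomain as the order completion of its domain: it is a lattice isomorphism
  onto an order dense and majorizing sublattice of a Dedekind complete vector lattice.  This
  determines the codomain up to a unique lattice isomorphism over \<open>\<iota>\<close>.\<close>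

definition order_completion ::
  "('a::archimedean_vector_lattice \<Rightarrow> 'd::dedekind_complete_vector_lattice) \<Rightarrow> bool" where
  "order_completion \<iota> \<longleftrightarrow> linear \<iota> \<and> inj \<iota> \<and> (\<forall>x y. \<iota> (sup x y) = sup (\<iota> x) (\<iota> y)) \<and>
     (\<forall>y>0. \<exists>x. 0 < \<iota> x \<and> \<iota> x \<le> y) \<and> (\<forall>y. \<exists>x. y \<le> \<iota> x)"

definition uniform_completion :: "'d::dedekind_complete_vector_lattice set \<Rightarrow> 'd set" where
  "uniform_completion X = \<Inter>{S. sublattice S \<and> X \<subseteq> S \<and> uniformly_complete S}"


subsection \<open>Independence of the index type\<close>

context
  fixes \<Lambda> :: "'i set" and le :: "'i \<Rightarrow> 'i \<Rightarrow> bool" and x :: "'i \<Rightarrow> 'v"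
begin

definition tail :: "'i \<Rightarrow> 'v set" where
  "tail \<alpha> = x ` {\<beta>\<in>\<Lambda>. le \<alpha> \<beta>}"

definition tail_index :: "'v net_index set" where
  "tail_index = {(A, a). a \<in> A \<and> (\<exists>\<alpha>\<in>\<Lambda>. tail \<alpha> \<subseteq> A) \<and> A \<subseteq> x ` \<Lambda>}"

definition tail_le :: "'v net_index \<Rightarrow> 'v net_index \<Rightarrow> bool" where
  "tail_le p q \<longleftrightarrow> fst q \<subseteq> fst p"

context
  assumes dir: "directed_set \<Lambda> le"
begin

lemma tail_in_index: "\<alpha> \<in> \<Lambda> \<Longrightarrow> (tail \<alpha>, x \<alpha>) \<in> tail_index"
  using dir by (auto simp: tail_index_def tail_def directed_set_def reflp_on_def)

lemma tail_antimono: "\<alpha> \<in> \<Lambda> \<Longrightarrow> \<beta> \<in> \<Lambda> \<Longrightarrow> le \<alpha> \<beta> \<Longrightarrow> tail \<beta> \<subseteq> tail \<alpha>"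
  using dir unfolding tail_def directed_set_def transp_on_def by blast

lemma directed_tail_index: "directed_set tail_index tail_le"
  unfolding directed_set_def
proof (intro conjI ballI)
  show "tail_index \<noteq> {}"
    using dir tail_in_index by (auto simp: directed_set_def)
  show "reflp_on tail_index tail_le" "transp_on tail_index tail_le"
    by (auto simp: reflp_on_def transp_on_def tail_le_def)
  fix p q assume "p \<in> tail_index" "q \<in> tail_index"
  then obtain \<alpha> \<beta> where ab: "\<alpha> \<in> \<Lambda>" "tail \<alpha> \<subseteq> fst p" "\<beta> \<in> \<Lambda>" "tail \<beta> \<subseteq> fst q"
    by (auto simp: tail_index_def)
  with dir obtain \<gamma> where g: "\<gamma> \<in> \<Lambda>" "le \<alpha> \<gamma>" "le \<beta> \<gamma>"
    unfolding directed_set_def by blast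
  have "tail \<gamma> \<subseteq> fst p" "tail \<gamma> \<subseteq> fst q"
    using ab g tail_antimono by blast+
  then show "\<exists>r\<in>tail_index. tail_le p r \<and> tail_le q r"
    using tail_in_index[OF g(1)] by (intro bexI[of _ "(tail \<gamma>, x \<gamma>)"]) (auto simp: tail_le_def)
qed

lemma net_in_tail_index: "net_in A \<Lambda> le x \<Longrightarrow> net_in A tail_index tail_le snd"
  using directed_tail_index unfolding net_in_def by (fastforce simp: tail_index_def)

lemma eventually_tail_index:
  "(\<exists>p0\<in>tail_index. \<forall>p\<in>tail_index. tail_le p0 p \<longrightarrow> P (snd p)) \<longleftrightarrow>
   (\<exists>\<alpha>0\<in>\<Lambda>. \<forall>\<alpha>\<in>\<Lambda>. le \<alpha>0 \<alpha> \<longrightarrow> P (x \<alpha>))" (is "?L \<longleftrightarrow> ?R")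
proof
  assume ?L
  then obtain p0 where p0: "p0 \<in> tail_index" "\<And>p. p \<in> tail_index \<Longrightarrow> tail_le p0 p \<Longrightarrow> P (snd p)"
    by blast
  then obtain \<alpha>0 where a0: "\<alpha>0 \<in> \<Lambda>" "tail \<alpha>0 \<subseteq> fst p0"
    by (auto simp: tail_index_def)
  have "P (x \<alpha>)" if "\<alpha> \<in> \<Lambda>" "le \<alpha>0 \<alpha>" for \<alpha>
    using p0(2)[OF tail_in_index[OF that(1)]] a0 tail_antimono[OF a0(1) that]
    by (auto simp: tail_le_def)
  with a0 show ?R by blast
next
  assume ?R
  then obtain \<alpha>0 where a0: "\<alpha>0 \<in> \<Lambda>" "\<And>\<alpha>. \<alpha> \<in> \<Lambda> \<Longrightarrow> le \<alpha>0 \<alpha> \<Longrightarrow> P (x \<alpha>)"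
    by blast
  have "P (snd p)" if "p \<in> tail_index" "tail_le (tail \<alpha>0, x \<alpha>0) p" for p
    using that a0(2) by (auto simp: tail_index_def tail_le_def tail_def)
  with tail_in_index[OF a0(1)] show ?L by blast
qed

lemma eventually_tail_index_prod:
  "(\<exists>p0\<in>tail_index \<times> tail_index. \<forall>p\<in>tail_index \<times> tail_index.
      rel_prod tail_le tail_le p0 p \<longrightarrow> P (snd (fst p)) (snd (snd p))) \<longleftrightarrow>
   (\<exists>\<alpha>0\<in>\<Lambda> \<times> \<Lambda>. \<forall>\<alpha>\<in>\<Lambda> \<times> \<Lambda>. rel_prod le le \<alpha>0 \<alpha> \<longrightarrow> P (x (fst \<alpha>)) (x (snd \<alpha>)))"
  (is "?L \<longleftrightarrow> ?R")
proof
  assume ?L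
  then obtain p0 q0 where p0: "p0 \<in> tail_index" "q0 \<in> tail_index"
    "\<And>p q. p \<in> tail_index \<Longrightarrow> q \<in> tail_index \<Longrightarrow> tail_le p0 p \<Longrightarrow> tail_le q0 q \<Longrightarrow> P (snd p) (snd q)"
    by force
  then obtain \<alpha>0 \<beta>0 where a0: "\<alpha>0 \<in> \<Lambda>" "tail \<alpha>0 \<subseteq> fst p0" and b0: "\<beta>0 \<in> \<Lambda>" "tail \<beta>0 \<subseteq> fst q0"
    by (auto simp: tail_index_def)
  have "P (x \<alpha>) (x \<beta>)" if "\<alpha> \<in> \<Lambda>" "le \<alpha>0 \<alpha>" "\<beta> \<in> \<Lambda>" "le \<beta>0 \<beta>" for \<alpha> \<beta>
    using p0(3)[OF tail_in_index[OF that(1)] tail_in_index[OF that(3)]] a0 b0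
      tail_antimono[OF a0(1) that(1,2)] tail_antimono[OF b0(1) that(3,4)]
    by (auto simp: tail_le_def)
  then show ?R using a0(1) b0(1) by (intro bexI[of _ "(\<alpha>0, \<beta>0)"]) auto
next
  assume ?R
  then obtain \<alpha>0 \<beta>0 where a0: "\<alpha>0 \<in> \<Lambda>" "\<beta>0 \<in> \<Lambda>"
    "\<And>\<alpha> \<beta>. \<alpha> \<in> \<Lambda> \<Longrightarrow> \<beta> \<in> \<Lambda> \<Longrightarrow> le \<alpha>0 \<alpha> \<Longrightarrow> le \<beta>0 \<beta> \<Longrightarrow> P (x \<alpha>) (x \<beta>)"
    by force
  have "P (snd p) (snd q)"
    if "p \<in> tail_index" "tail_le (tail \<alpha>0, x \<alpha>0) p" "q \<in> tail_index" "tail_le (tail \<beta>0, x \<beta>0) q" for p q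
  proof -
    have "snd p \<in> tail \<alpha>0" "snd q \<in> tail \<beta>0"
      using that by (auto simp: tail_index_def tail_le_def)
    then show ?thesis using a0(3) by (auto simp: tail_def)
  qed
  then show ?L
    using tail_in_index[OF a0(1)] tail_in_index[OF a0(2)]
    by (intro bexI[of _ "((tail \<alpha>0, x \<alpha>0), (tail \<beta>0, x \<beta>0))"]) auto
qed

end

end

lemma uniform_conv_tail_index:
  assumes "directed_set \<Lambda> le"
  shows "uniform_conv V (tail_index \<Lambda> le x) tail_le snd l \<longleftrightarrow> uniform_conv V \<Lambda> le x l"
  unfolding uniform_conv_def
  using eventually_tail_index[OF assms, of x "\<lambda>v. \<bar>v - l\<bar> \<le> c" for c] by simp

lemma sigma_order_conv_tail_index:
  assumes "directed_set \<Lambda> le"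
  shows "sigma_order_conv V (tail_index \<Lambda> le x) tail_le snd l \<longleftrightarrow> sigma_order_conv V \<Lambda> le x l"
  unfolding sigma_order_conv_def
  using eventually_tail_index[OF assms, of x "\<lambda>v. \<bar>v - l\<bar> \<le> c" for c] by simp

lemma uniformly_cauchy_tail_index:
  assumes "directed_set \<Lambda> le"
  shows "uniformly_cauchy V (tail_index \<Lambda> le x) tail_le snd \<longleftrightarrow> uniformly_cauchy V \<Lambda> le x"
  unfolding uniformly_cauchy_def uniform_conv_def case_prod_beta
  using eventually_tail_index_prod[OF assms, of x "\<lambda>v w. \<bar>v - w - 0\<bar> \<le> c" for c] by simp

lemma sigma_order_cauchy_tail_index:
  assumes "directed_set \<Lambda> le"
  shows "sigma_order_cauchy V (tail_index \<Lambda> le x) tail_le snd \<longleftrightarrow> sigma_order_cauchy V \<Lambda> le x"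
  unfolding sigma_order_cauchy_def sigma_order_conv_def case_prod_beta
  using eventually_tail_index_prod[OF assms, of x "\<lambda>v w. \<bar>v - w - 0\<bar> \<le> c" for c] by simp

lemma uniformly_completeD:
  fixes \<Lambda> :: "'i set"
  assumes "uniformly_complete V" "net_in V \<Lambda> le x" "uniformly_cauchy V \<Lambda> le x"
  shows "\<exists>l\<in>V. uniform_conv V \<Lambda> le x l"
proof -
  have d: "directed_set \<Lambda> le" using assms(2) by (simp add: net_in_def)
  show ?thesis
    using assms net_in_tail_index[OF d assms(2)]
    unfolding uniformly_complete_def
    by (metis uniform_conv_tail_index[OF d] uniformly_cauchy_tail_index[OF d])
qed

lemma sigma_order_completeD:
  fixes \<Lambda> :: "'i set"
  assumes "sigma_order_complete V" "net_in V \<Lambda> le x" "sigma_order_cauchy V \<Lambda> le x"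
  shows "\<exists>l\<in>V. sigma_order_conv V \<Lambda> le x l"
proof -
  have d: "directed_set \<Lambda> le" using assms(2) by (simp add: net_in_def)
  show ?thesis
    using assms net_in_tail_index[OF d assms(2)]
    unfolding sigma_order_complete_def
    by (metis sigma_order_conv_tail_index[OF d] sigma_order_cauchy_tail_index[OF d])
qed

lemma uniform_adherenceI:
  fixes \<Lambda> :: "'i set"
  assumes "net_in A \<Lambda> le x" "uniform_conv V \<Lambda> le x l" "l \<in> V"
  shows "l \<in> uniform_adherence V A"
proof -
  have d: "directed_set \<Lambda> le" using assms(1) by (simp add: net_in_def)
  show ?thesis
    using assms net_in_tail_index[OF d assms(1)] uniform_conv_tail_index[OF d]
    unfolding uniform_adherence_def by blast
qed

end

theory Submission
  imports Defs "HOL-Library.Nat_Bijection"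
begin

text \<open>Write \<open>Y\<close> for the uniform adherence of \<open>X\<close> in \<open>X\<^sup>\<delta>\<close>.  If sequences of \<open>X\<close> that decrease to zero
  do so uniformly, then \<open>y \<in> Y\<close> exactly when \<open>y\<close> is both the infimum of a decreasing sequence and the
  supremum of an increasing sequence of \<open>X\<close>: the difference of the two sequences decreases to zero in
  \<open>X\<close>, and its regulator witnesses \<open>y \<in> Y\<close>.  Unlike regulators, countable infima can be iterated, by
  enumerating a double sequence.  This shows that \<open>Y\<close> is uniformly closed, and that a sequence of
  \<open>Y\<close> decreasing to zero is dominated by one of \<open>X\<close> decreasing to zero, so that the two convergences
  agree in \<open>Y\<close>.  Cauchy nets of \<open>Y\<close> converge in \<open>X\<^sup>\<delta>\<close> by Dedekind completeness, hence in \<open>Y\<close>.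
  Conversely, a point of \<open>Y\<close> is the limit of a sequence of \<open>X\<close> that is Cauchy in every sublattice
  containing \<open>X\<close>, and limits there are the same as in \<open>X\<^sup>\<delta>\<close> because \<open>X\<close> is order dense.\<close>

section \<open>Vector lattices\<close>

lemma abs_diff_le_iff_lattice:
  fixes a b c :: "'v::vector_lattice"
  shows "\<bar>a - b\<bar> \<le> c \<longleftrightarrow> a \<le> b + c \<and> b \<le> a + c"
  by (simp add: abs_le_iff algebra_simps)

text \<open>Passing from n to n + 1 shows that the supremum \<open>s\<close> of the multiples of
  \<open>x\<close> stays an upper bound after subtracting \<open>x\<close>, so
  \<open>s \<le> s - x\<close>. No sign is assumed of \<open>x\<close>.\<close>

lemma dedekind_archimedean:
  fixes x y :: "'d::dedekind_complete_vector_lattice"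
  assumes "\<And>n::nat. real n *\<^sub>R x \<le> y"
  shows "x \<le> 0"
proof -
  define s where "s = Sup (range (\<lambda>n::nat. real n *\<^sub>R x))"
  have bdd: "bdd_above (range (\<lambda>n::nat. real n *\<^sub>R x))"
    using assms by (intro bdd_aboveI) auto
  have "real n *\<^sub>R x \<le> s - x" for n
  proof -
    have "real (Suc n) *\<^sub>R x \<le> s"
      unfolding s_def by (intro cSup_upper bdd) blast
    then show ?thesis by (simp add: algebra_simps)
  qed
  then have "s \<le> s - x"
    unfolding s_def[symmetric] by (subst s_def, intro cSup_least) auto
  then show ?thesis by (simp add: algebra_simps)
qed

lemma dedekind_le_if_le_add_scaleR:
  fixes x y e :: "'d::dedekind_complete_vector_lattice"
  assumes "\<And>n::nat. x \<le> y + (c / real (Suc n)) *\<^sub>R e" and "0 < c"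
  shows "x \<le> y"
proof -
  \<comment> \<open>The supremum with 0 covers n = 0, since \<open>e\<close> may have any
    sign.\<close>
  have "real n *\<^sub>R (x - y) \<le> sup (c *\<^sub>R e) 0" for n
  proof (cases n)
    case 0
    then show ?thesis by simp
  next
    case (Suc m)
    have "real n *\<^sub>R (x - y) \<le> real n *\<^sub>R ((c / real n) *\<^sub>R e)"
      using assms(1)[of m] Suc by (intro scaleR_left_mono) (simp_all add: algebra_simps)
    also have "\<dots> = c *\<^sub>R e" using Suc by simp
    also have "\<dots> \<le> sup (c *\<^sub>R e) 0" by simp
    finally show ?thesis .
  qed
  from dedekind_archimedean[OF this] show ?thesis by simp
qed

lemma abs_sup_diff_le:
  fixes a b c d :: "'v::vector_lattice"
  shows "\<bar>sup a b - sup c d\<bar> \<le> \<bar>a - c\<bar> + \<bar>b - d\<bar>"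
proof -
  have 1: "sup a b \<le> sup c d + (\<bar>a - c\<bar> + \<bar>b - d\<bar>)" for a b c d :: 'v
  proof (rule sup_least)
    have "a = c + (a - c)" by simp
    also have "\<dots> \<le> sup c d + (\<bar>a - c\<bar> + \<bar>b - d\<bar>)"
      by (intro add_mono sup_ge1) (metis abs_ge_self abs_ge_zero add_increasing2)
    finally show "a \<le> sup c d + (\<bar>a - c\<bar> + \<bar>b - d\<bar>)" .
    have "b = d + (b - d)" by simp
    also have "\<dots> \<le> sup c d + (\<bar>a - c\<bar> + \<bar>b - d\<bar>)"
      by (intro add_mono sup_ge2) (metis abs_ge_self abs_ge_zero add_increasing)
    finally show "b \<le> sup c d + (\<bar>a - c\<bar> + \<bar>b - d\<bar>)" .
  qed
  show ?thesis
    unfolding abs_diff_le_iff_lattice using 1[of a b c d] 1[of c d a b]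
    by (simp add: abs_minus_commute)
qed

lemma abs_scaleR_le:
  fixes x :: "'v::vector_lattice"
  shows "\<bar>c *\<^sub>R x\<bar> \<le> \<bar>c\<bar> *\<^sub>R \<bar>x\<bar>"
proof (cases "c \<ge> 0")
  case True
  then show ?thesis
    using scaleR_left_mono[OF abs_ge_self, of c x] scaleR_left_mono[OF abs_ge_minus_self, of c x]
    by (intro abs_leI) simp_all
next
  case False
  then show ?thesis
    using scaleR_left_mono[OF abs_ge_self, of "- c" x]
      scaleR_left_mono[OF abs_ge_minus_self, of "- c" x]
    by (intro abs_leI) simp_all
qed

lemma sublattice_inf:
  assumes "sublattice S" "x \<in> S" "y \<in> S"
  shows "inf x y \<in> S"
  unfolding inf_eq_neg_sup
  using assms by (intro subspace_neg) (auto simp: sublattice_def intro: subspace_neg)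

text \<open>Finite infima turn any sequence into a decreasing one with the same common lower bounds.
  Describing \<open>u\<close> by its lower bounds hides the recursion from later proofs.\<close>

lemma sublattice_running_inf:
  fixes g :: "nat \<Rightarrow> 'v::vector_lattice"
  assumes S: "sublattice S" and g: "range g \<subseteq> S"
  shows "\<exists>u. range u \<subseteq> S \<and> antimono u \<and> (\<forall>n v. v \<le> u n \<longleftrightarrow> (\<forall>m\<le>n. v \<le> g m))"
proof -
  define u where "u = rec_nat (g 0) (\<lambda>n w. inf w (g (Suc n)))"
  have u: "u 0 = g 0" "u (Suc n) = inf (u n) (g (Suc n))" for n
    by (simp_all add: u_def)
  have "u n \<in> S" for n
    using g by (induction n) (auto simp: u intro!: sublattice_inf[OF S])
  moreover have le: "v \<le> u n \<longleftrightarrow> (\<forall>m\<le>n. v \<le> g m)" for n v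
    by (induction n) (auto simp: u le_Suc_eq)
  moreover have "antimono u"
    unfolding antimono_def using le by (meson order_refl order_trans)
  ultimately show ?thesis by blast
qed

section \<open>Convergence and adherence\<close>

lemma directed_set_nat: "directed_set (UNIV :: nat set) (\<le>)"
proof -
  have "\<exists>k. m \<le> k \<and> n \<le> k" for m n :: nat
    by (meson max.cobounded1 max.cobounded2)
  then show ?thesis
    by (simp add: directed_set_def reflp_on_def transp_on_def)
qed

text \<open>This removes nets from the adherence. One point of \<open>A\<close> per \<epsilon> is
  enough, because the choices for \<epsilon> = 1 / (n + 1) already form a convergent sequence;
  conversely, the first index of a tail belongs to that tail by reflexivity.\<close>

lemma mem_uniform_adherence_iff:
  "l \<in> uniform_adherence UNIV A \<longleftrightarrow> (\<exists>e\<ge>0. \<forall>\<epsilon>>0. \<exists>x\<in>A. \<bar>x - l\<bar> \<le> \<epsilon> *\<^sub>R e)" (is "?L \<longleftrightarrow> ?R")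
proof
  assume ?L
  then obtain \<Lambda> :: "'a net_index set" and le x where
    net: "net_in A \<Lambda> le x" and conv: "uniform_conv UNIV \<Lambda> le x l"
    unfolding uniform_adherence_def by auto
  have x: "x \<alpha> \<in> A" "le \<alpha> \<alpha>" if "\<alpha> \<in> \<Lambda>" for \<alpha>
    using net that by (auto simp: net_in_def directed_set_def reflp_on_def)
  from conv obtain e where e: "0 \<le> e"
    "\<And>\<epsilon>. \<epsilon> > 0 \<Longrightarrow> \<exists>\<alpha>0\<in>\<Lambda>. \<forall>\<alpha>\<in>\<Lambda>. le \<alpha>0 \<alpha> \<longrightarrow> \<bar>x \<alpha> - l\<bar> \<le> \<epsilon> *\<^sub>R e"
    unfolding uniform_conv_def by blast
  have "\<exists>x\<in>A. \<bar>x - l\<bar> \<le> \<epsilon> *\<^sub>R e" if \<epsilon>: "\<epsilon> > 0" for \<epsilon>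
  proof -
    obtain \<alpha> where "\<alpha> \<in> \<Lambda>" "\<And>\<beta>. \<beta> \<in> \<Lambda> \<Longrightarrow> le \<alpha> \<beta> \<Longrightarrow> \<bar>x \<beta> - l\<bar> \<le> \<epsilon> *\<^sub>R e"
      using e(2)[OF \<epsilon>] by blast
    with x show ?thesis by blast
  qed
  with e(1) show ?R by blast
next
  assume ?R
  then obtain e where e: "0 \<le> e" "\<And>\<epsilon>. \<epsilon> > 0 \<Longrightarrow> \<exists>x\<in>A. \<bar>x - l\<bar> \<le> \<epsilon> *\<^sub>R e" by blast
  have "\<forall>n. \<exists>x\<in>A. \<bar>x - l\<bar> \<le> (1 / real (Suc n)) *\<^sub>R e" by (intro allI e(2)) simp
  then obtain x where x: "\<And>n. x n \<in> A" "\<And>n. \<bar>x n - l\<bar> \<le> (1 / real (Suc n)) *\<^sub>R e" by metis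
  have "\<exists>N. \<forall>n\<ge>N. \<bar>x n - l\<bar> \<le> \<epsilon> *\<^sub>R e" if \<epsilon>: "\<epsilon> > 0" for \<epsilon>
  proof -
    obtain N where N: "1 / real (Suc N) < \<epsilon>" by (rule nat_approx_posE[OF \<epsilon>])
    have "\<bar>x n - l\<bar> \<le> \<epsilon> *\<^sub>R e" if "N \<le> n" for n
    proof -
      have "1 / real (Suc n) \<le> 1 / real (Suc N)"
        using that by (intro divide_left_mono) auto
      then have "1 / real (Suc n) \<le> \<epsilon>" using N by linarith
      from order_trans[OF x(2) scaleR_right_mono[OF this e(1)]] show ?thesis .
    qed
    then show ?thesis by blast
  qed
  then have conv: "uniform_conv UNIV (UNIV :: nat set) (\<le>) x l"
    using e(1) unfolding uniform_conv_def by auto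
  have "net_in A (UNIV :: nat set) (\<le>) x"
    using x(1) directed_set_nat by (auto simp: net_in_def)
  from uniform_adherenceI[OF this conv UNIV_I] show ?L .
qed

lemma uniform_adherence_mono: "A \<subseteq> B \<Longrightarrow> uniform_adherence UNIV A \<subseteq> uniform_adherence UNIV B"
  by (auto simp: mem_uniform_adherence_iff; blast)

lemma subset_uniform_adherence: "A \<subseteq> uniform_adherence UNIV A"
proof
  fix l assume "l \<in> A"
  then show "l \<in> uniform_adherence UNIV A"
    unfolding mem_uniform_adherence_iff by (intro exI[of _ 0]) auto
qed

lemma decreases_to_zero_scaleR:
  fixes e :: "'d::dedekind_complete_vector_lattice"
  assumes "subspace V" "e \<in> V" "0 \<le> e" "0 < c"
  shows "decreases_to_zero V (\<lambda>n. (c / real (Suc n)) *\<^sub>R e)"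
  unfolding decreases_to_zero_def
proof (intro conjI ballI impI allI)
  show "range (\<lambda>n. (c / real (Suc n)) *\<^sub>R e) \<subseteq> V"
    using assms by (auto intro: subspace_scale)
  show "antimono (\<lambda>n. (c / real (Suc n)) *\<^sub>R e)"
    using assms by (intro antimonoI scaleR_right_mono divide_left_mono) auto
  show "0 \<le> (c / real (Suc n)) *\<^sub>R e" for n
    using assms by (intro scaleR_nonneg_nonneg) auto
  show "v \<le> 0" if "\<forall>n. v \<le> (c / real (Suc n)) *\<^sub>R e" for v
    using dedekind_le_if_le_add_scaleR[of v 0 c e] that assms by simp
qed

lemma uniform_conv_imp_sigma_order_conv:
  fixes V :: "'d::dedekind_complete_vector_lattice set"
  assumes V: "subspace V" and "uniform_conv V \<Lambda> le x l"
  shows "sigma_order_conv V \<Lambda> le x l"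
proof -
  obtain e where e: "e \<in> V" "0 \<le> e"
    "\<And>\<epsilon>. \<epsilon> > 0 \<Longrightarrow> \<exists>\<alpha>0\<in>\<Lambda>. \<forall>\<alpha>\<in>\<Lambda>. le \<alpha>0 \<alpha> \<longrightarrow> \<bar>x \<alpha> - l\<bar> \<le> \<epsilon> *\<^sub>R e"
    using assms(2) unfolding uniform_conv_def by blast
  have "decreases_to_zero V (\<lambda>n. (1 / real (Suc n)) *\<^sub>R e)"
    by (rule decreases_to_zero_scaleR[OF V e(1,2)]) simp
  moreover have "\<exists>\<alpha>0\<in>\<Lambda>. \<forall>\<alpha>\<in>\<Lambda>. le \<alpha>0 \<alpha> \<longrightarrow> \<bar>x \<alpha> - l\<bar> \<le> (1 / real (Suc n)) *\<^sub>R e" for n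
    by (rule e(3)) simp
  ultimately show ?thesis
    unfolding sigma_order_conv_def by blast
qed

text \<open>A regulator in the smaller carrier remains one in the larger. Dominating sequences are
  more delicate, since an infimum depends on the carrier; see
  \<open>decreases_to_zero_UNIV\<close>.\<close>

lemma uniform_conv_mono: "uniform_conv V \<Lambda> le x l \<Longrightarrow> V \<subseteq> W \<Longrightarrow> uniform_conv W \<Lambda> le x l"
  unfolding uniform_conv_def by (elim bexE) (rule bexI, assumption, erule (1) subsetD)

text \<open>Countably many indices \<open>\<gamma> n\<close> control the whole net, and Dedekind
  completeness provides the supremum of the lower estimates \<open>x (\<gamma> n) - d n\<close>. The
  limit may leave \<open>V\<close>, but the regulator does not.\<close>

lemma uniformly_cauchy_imp_uniform_conv:
  fixes V :: "'d::dedekind_complete_vector_lattice set"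
  assumes net: "net_in V \<Lambda> le x" and "uniformly_cauchy V \<Lambda> le x"
  shows "\<exists>l. uniform_conv V \<Lambda> le x l"
proof -
  have dir: "\<And>\<alpha> \<beta>. \<alpha> \<in> \<Lambda> \<Longrightarrow> \<beta> \<in> \<Lambda> \<Longrightarrow> \<exists>\<gamma>\<in>\<Lambda>. le \<alpha> \<gamma> \<and> le \<beta> \<gamma>"
    and trans: "\<And>\<alpha> \<beta> \<gamma>. \<alpha> \<in> \<Lambda> \<Longrightarrow> \<beta> \<in> \<Lambda> \<Longrightarrow> \<gamma> \<in> \<Lambda> \<Longrightarrow> le \<alpha> \<beta> \<Longrightarrow> le \<beta> \<gamma> \<Longrightarrow> le \<alpha> \<gamma>"
    and refl: "\<And>\<alpha>. \<alpha> \<in> \<Lambda> \<Longrightarrow> le \<alpha> \<alpha>"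
    using net unfolding net_in_def directed_set_def transp_on_def reflp_on_def by blast+
  obtain e where e: "e \<in> V" "0 \<le> e"
    and "\<And>\<epsilon>. \<epsilon> > 0 \<Longrightarrow> \<exists>p\<in>\<Lambda> \<times> \<Lambda>. \<forall>q\<in>\<Lambda> \<times> \<Lambda>. rel_prod le le p q \<longrightarrow>
      \<bar>(case q of (\<alpha>, \<beta>) \<Rightarrow> x \<alpha> - x \<beta>) - 0\<bar> \<le> \<epsilon> *\<^sub>R e"
    using assms(2) unfolding uniformly_cauchy_def uniform_conv_def by blast
  then have ev: "\<exists>\<alpha>0\<in>\<Lambda>. \<exists>\<beta>0\<in>\<Lambda>. \<forall>\<alpha>\<in>\<Lambda>. \<forall>\<beta>\<in>\<Lambda>. le \<alpha>0 \<alpha> \<longrightarrow> le \<beta>0 \<beta> \<longrightarrow> \<bar>x \<alpha> - x \<beta>\<bar> \<le> \<epsilon> *\<^sub>R e"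
    if \<epsilon>: "\<epsilon> > 0" for \<epsilon>
    using that by fastforce
  \<comment> \<open>Directedness merges the two thresholds of the product net into one.\<close>
  have "\<exists>\<gamma>\<in>\<Lambda>. \<forall>\<alpha>\<in>\<Lambda>. \<forall>\<beta>\<in>\<Lambda>. le \<gamma> \<alpha> \<longrightarrow> le \<gamma> \<beta> \<longrightarrow> \<bar>x \<alpha> - x \<beta>\<bar> \<le> \<epsilon> *\<^sub>R e" if \<epsilon>: "\<epsilon> > 0" for \<epsilon>
  proof -
    obtain \<alpha>0 \<beta>0 where ab: "\<alpha>0 \<in> \<Lambda>" "\<beta>0 \<in> \<Lambda>"
      "\<And>\<alpha> \<beta>. \<alpha> \<in> \<Lambda> \<Longrightarrow> \<beta> \<in> \<Lambda> \<Longrightarrow> le \<alpha>0 \<alpha> \<Longrightarrow> le \<beta>0 \<beta> \<Longrightarrow> \<bar>x \<alpha> - x \<beta>\<bar> \<le> \<epsilon> *\<^sub>R e"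
      using ev[OF \<epsilon>] by blast
    obtain \<gamma> where \<gamma>: "\<gamma> \<in> \<Lambda>" "le \<alpha>0 \<gamma>" "le \<beta>0 \<gamma>" using dir[OF ab(1,2)] by blast
    have "\<bar>x \<alpha> - x \<beta>\<bar> \<le> \<epsilon> *\<^sub>R e" if "\<alpha> \<in> \<Lambda>" "\<beta> \<in> \<Lambda>" "le \<gamma> \<alpha>" "le \<gamma> \<beta>" for \<alpha> \<beta>
      using trans[OF ab(1) \<gamma>(1) that(1) \<gamma>(2) that(3)] trans[OF ab(2) \<gamma>(1) that(2) \<gamma>(3) that(4)]
      by (intro ab(3) that)
    with \<gamma>(1) show ?thesis by blast
  qed
  then have "\<forall>n. \<exists>\<gamma>\<in>\<Lambda>. \<forall>\<alpha>\<in>\<Lambda>. \<forall>\<beta>\<in>\<Lambda>. le \<gamma> \<alpha> \<longrightarrow> le \<gamma> \<beta> \<longrightarrow>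
      \<bar>x \<alpha> - x \<beta>\<bar> \<le> (1 / real (Suc n)) *\<^sub>R e"
    by (intro allI) simp
  then obtain \<gamma> where g: "\<And>n. \<gamma> n \<in> \<Lambda>"
    "\<And>n \<alpha> \<beta>. \<alpha> \<in> \<Lambda> \<Longrightarrow> \<beta> \<in> \<Lambda> \<Longrightarrow> le (\<gamma> n) \<alpha> \<Longrightarrow> le (\<gamma> n) \<beta> \<Longrightarrow>
      \<bar>x \<alpha> - x \<beta>\<bar> \<le> (1 / real (Suc n)) *\<^sub>R e"
    by metis
  define d where "d n = (1 / real (Suc n)) *\<^sub>R e" for n
  have near: "x \<alpha> \<le> x (\<gamma> n) + d n \<and> x (\<gamma> n) \<le> x \<alpha> + d n" if "\<alpha> \<in> \<Lambda>" "le (\<gamma> n) \<alpha>" for n \<alpha>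
    using g(2)[OF that(1) g(1) that(2) refl[OF g(1)]] unfolding abs_diff_le_iff_lattice d_def .
  \<comment> \<open>Any two tails share an index, so every lower estimate lies below every upper
    one.\<close>
  have cross: "x (\<gamma> n) - d n \<le> x (\<gamma> m) + d m" for n m
  proof -
    obtain \<alpha> where "\<alpha> \<in> \<Lambda>" "le (\<gamma> n) \<alpha>" "le (\<gamma> m) \<alpha>" using dir g(1) by blast
    then have "x (\<gamma> n) - d n \<le> x \<alpha>" "x \<alpha> \<le> x (\<gamma> m) + d m"
      using near unfolding diff_le_eq by blast+
    then show ?thesis by (rule order_trans)
  qed
  define l where "l = Sup (range (\<lambda>n. x (\<gamma> n) - d n))"
  have l1: "x (\<gamma> n) - d n \<le> l" for n
    unfolding l_def by (rule cSup_upper) (auto intro!: bdd_aboveI[of _ "x (\<gamma> 0) + d 0"] cross)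
  have l2: "l \<le> x (\<gamma> m) + d m" for m
    unfolding l_def by (rule cSup_least) (auto intro: cross)
  \<comment> \<open>Both \<open>x \<alpha>\<close> and \<open>l\<close> are within
    \<open>d n\<close> of \<open>x (\<gamma> n)\<close>.\<close>
  have lim: "\<bar>x \<alpha> - l\<bar> \<le> d n + d n" if "\<alpha> \<in> \<Lambda>" "le (\<gamma> n) \<alpha>" for n \<alpha>
  proof -
    have "x \<alpha> \<le> (l + d n) + d n"
      using near[OF that] add_right_mono[OF l1[of n, unfolded diff_le_eq], of "d n"]
      by (blast intro: order_trans)
    moreover have "l \<le> (x \<alpha> + d n) + d n"
      using order_trans[OF l2 add_right_mono[OF conjunct2[OF near[OF that]]]] .
    ultimately show ?thesis unfolding abs_diff_le_iff_lattice by (simp add: add.assoc)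
  qed
  have "\<exists>\<alpha>0\<in>\<Lambda>. \<forall>\<alpha>\<in>\<Lambda>. le \<alpha>0 \<alpha> \<longrightarrow> \<bar>x \<alpha> - l\<bar> \<le> \<epsilon> *\<^sub>R e" if \<epsilon>: "\<epsilon> > 0" for \<epsilon>
  proof -
    obtain n where n: "1 / real (Suc n) < \<epsilon> / 2"
      using \<epsilon> by (metis half_gt_zero nat_approx_posE)
    have "d n + d n = (2 / real (Suc n)) *\<^sub>R e"
      unfolding d_def by (simp flip: scaleR_add_left)
    also have "\<dots> \<le> \<epsilon> *\<^sub>R e" using n e(2) by (intro scaleR_right_mono) (auto simp: field_simps)
    finally have "\<bar>x \<alpha> - l\<bar> \<le> \<epsilon> *\<^sub>R e" if "\<alpha> \<in> \<Lambda>" "le (\<gamma> n) \<alpha>" for \<alpha>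
      using order_trans[OF lim[OF that]] by blast
    then show ?thesis using g(1) by blast
  qed
  then show ?thesis using e unfolding uniform_conv_def by blast
qed

section \<open>Order dense majorizing sublattices\<close>

text \<open>\<open>X\<close> stands for the copy of the given vector lattice inside its order
  completion. The agreement of the convergences enters only through \<open>regulator\<close>, whose
  \<open>e\<close> may be any element of the ambient space, as \<open>majorizing\<close> can replace
  it by one of \<open>X\<close>.\<close>

locale regulated_sublattice =
  fixes X :: "'d::dedekind_complete_vector_lattice set"
  assumes sublattice: "sublattice X"
    and order_dense: "\<And>y. y > 0 \<Longrightarrow> \<exists>x\<in>X. 0 < x \<and> x \<le> y"
    and majorizing: "\<And>y. \<exists>x\<in>X. y \<le> x"
    and regulator: "\<And>z. decreases_to_zero X z \<Longrightarrow> \<exists>e\<ge>0. \<forall>\<epsilon>>0. \<exists>n. z n \<le> \<epsilon> *\<^sub>R e"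
begin

abbreviation Y :: "'d set" where "Y \<equiv> uniform_adherence UNIV X"

lemma majorizing_nonneg: "\<exists>x\<in>X. 0 \<le> x \<and> y \<le> x"
  using majorizing[of "sup y 0"] by auto

lemma subspace_X: "subspace X"
  using sublattice by (simp add: sublattice_def)

text \<open>If an ambient lower bound had a nonzero positive part, order density would put a nonzero
  positive element of \<open>X\<close> below that part, and this would be a lower bound inside
  \<open>S\<close>. Hence infimum zero does not depend on the carrier.\<close>

lemma decreases_to_zero_UNIV:
  assumes "decreases_to_zero S z" "X \<subseteq> S"
  shows "decreases_to_zero UNIV z"
proof -
  have "v \<le> 0" if v: "\<And>n. v \<le> z n" for v
  proof (rule ccontr)
    assume "\<not> v \<le> 0"
    then have "sup v 0 > 0" by (simp add: less_le_not_le)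
    then obtain x where x: "x \<in> X" "0 < x" "x \<le> sup v 0" using order_dense by blast
    have "sup v 0 \<le> z n" for n using v assms(1) by (simp add: decreases_to_zero_def)
    then have "\<forall>n. x \<le> z n" using order_trans[OF x(3)] by blast
    with x assms have "x \<le> 0" unfolding decreases_to_zero_def by blast
    with x(2) show False by simp
  qed
  with assms(1) show ?thesis unfolding decreases_to_zero_def by blast
qed

text \<open>The operations are Lipschitz for the modulus, so regulators \<open>e\<close> and
  \<open>f\<close> combine to \<open>\<bar>c\<bar> *\<^sub>R e + f\<close> and
  \<open>e + f\<close>.\<close>

lemma sublattice_adherence: "sublattice Y"
proof -
  have comb: "c *\<^sub>R y + z \<in> Y \<and> sup y z \<in> Y" if yz: "y \<in> Y" "z \<in> Y" for y z c
  proof -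
    obtain e where e: "0 \<le> e" "\<And>\<epsilon>. \<epsilon> > 0 \<Longrightarrow> \<exists>x\<in>X. \<bar>x - y\<bar> \<le> \<epsilon> *\<^sub>R e"
      using yz(1) unfolding mem_uniform_adherence_iff by blast
    obtain f where f: "0 \<le> f" "\<And>\<epsilon>. \<epsilon> > 0 \<Longrightarrow> \<exists>x\<in>X. \<bar>x - z\<bar> \<le> \<epsilon> *\<^sub>R f"
      using yz(2) unfolding mem_uniform_adherence_iff by blast
    have lin: "\<exists>x\<in>X. \<bar>x - (c *\<^sub>R y + z)\<bar> \<le> \<epsilon> *\<^sub>R (\<bar>c\<bar> *\<^sub>R e + f)" if \<epsilon>: "\<epsilon> > 0" for \<epsilon>
    proof -
      obtain x where x: "x \<in> X" "\<bar>x - y\<bar> \<le> \<epsilon> *\<^sub>R e" using e(2)[OF \<epsilon>] by blast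
      obtain w where w: "w \<in> X" "\<bar>w - z\<bar> \<le> \<epsilon> *\<^sub>R f" using f(2)[OF \<epsilon>] by blast
      have sc: "\<bar>c *\<^sub>R (x - y)\<bar> \<le> \<bar>c\<bar> *\<^sub>R \<epsilon> *\<^sub>R e"
        by (rule order_trans[OF abs_scaleR_le scaleR_left_mono[OF x(2) abs_ge_zero]])
      have "c *\<^sub>R x + w - (c *\<^sub>R y + z) = c *\<^sub>R (x - y) + (w - z)"
        by (simp add: algebra_simps)
      then have "\<bar>c *\<^sub>R x + w - (c *\<^sub>R y + z)\<bar> \<le> \<bar>c *\<^sub>R (x - y)\<bar> + \<bar>w - z\<bar>"
        by (simp only: abs_triangle_ineq)
      also have "\<dots> \<le> \<bar>c\<bar> *\<^sub>R \<epsilon> *\<^sub>R e + \<epsilon> *\<^sub>R f" by (intro add_mono sc w)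
      also have "\<dots> = \<epsilon> *\<^sub>R (\<bar>c\<bar> *\<^sub>R e + f)" by (simp add: algebra_simps)
      finally show ?thesis
        using subspace_add[OF subspace_X subspace_scale[OF subspace_X x(1)] w(1)] by blast
    qed
    have sup: "\<exists>x\<in>X. \<bar>x - sup y z\<bar> \<le> \<epsilon> *\<^sub>R (e + f)" if \<epsilon>: "\<epsilon> > 0" for \<epsilon>
    proof -
      obtain x where x: "x \<in> X" "\<bar>x - y\<bar> \<le> \<epsilon> *\<^sub>R e" using e(2)[OF \<epsilon>] by blast
      obtain w where w: "w \<in> X" "\<bar>w - z\<bar> \<le> \<epsilon> *\<^sub>R f" using f(2)[OF \<epsilon>] by blast
      have "\<bar>sup x w - sup y z\<bar> \<le> \<epsilon> *\<^sub>R (e + f)"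
        using order_trans[OF abs_sup_diff_le add_mono[OF x(2) w(2)]] by (simp add: scaleR_add_right)
      then show ?thesis using x(1) w(1) sublattice unfolding sublattice_def by blast
    qed
    have "0 \<le> \<bar>c\<bar> *\<^sub>R e + f" "0 \<le> e + f"
      using e(1) f(1) by (simp_all add: scaleR_nonneg_nonneg)
    then show ?thesis
      unfolding mem_uniform_adherence_iff
      by (intro conjI exI[of _ "\<bar>c\<bar> *\<^sub>R e + f"] exI[of _ "e + f"] allI impI lin sup)
  qed
  have 0: "0 \<in> Y" using subset_uniform_adherence subspace_0[OF subspace_X] by blast
  have "subspace Y"
  proof (rule subspaceI)
    show "x + y \<in> Y" if "x \<in> Y" "y \<in> Y" for x y using comb[OF that, THEN conjunct1, of 1] by simp
    show "c *\<^sub>R x \<in> Y" if "x \<in> Y" for c x using comb[OF that 0, THEN conjunct1, of c] by simp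
  qed (rule 0)
  then show ?thesis using comb unfolding sublattice_def by simp
qed

lemma subspace_adherence: "subspace Y"
  using sublattice_adherence by (simp add: sublattice_def)

section \<open>Countable infima and idempotence of the adherence\<close>

definition seq_inf :: "'d \<Rightarrow> bool" where
  "seq_inf y \<longleftrightarrow> (\<exists>u. range u \<subseteq> X \<and> antimono u \<and> (\<forall>v. (\<forall>n::nat. v \<le> u n) \<longleftrightarrow> v \<le> y))"

text \<open>Adding its error bound \<open>d k\<close> to an approximant puts it above
  \<open>y\<close> at distance at most \<open>2 d k\<close>. The infimum is expressed through lower
  bounds in the whole space. Both A = X and A = Y are needed later.\<close>

lemma adherence_above:
  assumes A: "subspace A" "X \<subseteq> A" and "y \<in> uniform_adherence UNIV A"
  shows "\<exists>x. range x \<subseteq> A \<and> (\<forall>v. (\<forall>k::nat. v \<le> x k) \<longleftrightarrow> v \<le> y)"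
proof -
  obtain e where e: "0 \<le> e" "\<And>\<epsilon>. \<epsilon> > 0 \<Longrightarrow> \<exists>x\<in>A. \<bar>x - y\<bar> \<le> \<epsilon> *\<^sub>R e"
    using assms(3) unfolding mem_uniform_adherence_iff by blast
  \<comment> \<open>A regulator from \<open>X\<close> keeps the shifts \<open>d k\<close> inside
    \<open>A\<close>.\<close>
  obtain e' where e': "e' \<in> X" "e \<le> e'" using majorizing by blast
  define d where "d k = (1 / real (Suc k)) *\<^sub>R e'" for k
  have "\<exists>x\<in>A. \<bar>x - y\<bar> \<le> d k" for k
  proof -
    have "(1 / real (Suc k)) *\<^sub>R e \<le> d k"
      unfolding d_def using e' by (intro scaleR_left_mono) auto
    moreover obtain x where "x \<in> A" "\<bar>x - y\<bar> \<le> (1 / real (Suc k)) *\<^sub>R e"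
      using e(2)[of "1 / real (Suc k)"] by auto
    ultimately show ?thesis using order_trans by blast
  qed
  then obtain x where x: "\<And>k. x k \<in> A" "\<And>k. \<bar>x k - y\<bar> \<le> d k" by metis
  have d: "d k \<in> A" for k unfolding d_def using e'(1) A by (auto intro: subspace_scale)
  show ?thesis
  proof (intro exI conjI allI iffI)
    show "range (\<lambda>k. x k + d k) \<subseteq> A"
      using x(1) d A(1) by (auto intro: subspace_add)
    show "v \<le> x k + d k" if "v \<le> y" for v k
      using x(2)[of k] order_trans[OF that] unfolding abs_diff_le_iff_lattice by blast
    show "v \<le> y" if v: "\<forall>k. v \<le> x k + d k" for v
    proof (rule dedekind_le_if_le_add_scaleR)
      fix k
      have "v \<le> x k + d k" using v by blast
      also have "\<dots> \<le> (y + d k) + d k"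
        using x(2)[of k] unfolding abs_diff_le_iff_lattice by (intro add_right_mono) blast
      also have "\<dots> = y + (2 / real (Suc k)) *\<^sub>R e'"
        unfolding d_def by (simp add: add.assoc flip: scaleR_add_left)
      finally show "v \<le> y + (2 / real (Suc k)) *\<^sub>R e'" .
    qed simp
  qed
qed

text \<open>Each \<open>a n\<close> is the infimum of a sequence in \<open>X\<close>; the running
  infimum of the enumerated double sequence has infimum \<open>y\<close>. The last property lets
  \<open>u\<close> dominate \<open>a\<close> whenever \<open>a\<close> is decreasing.\<close>

lemma adherence_seq_inf_above:
  assumes a: "range a \<subseteq> Y" and y: "\<And>v. (\<forall>n::nat. v \<le> a n) \<longleftrightarrow> v \<le> y"
  obtains u where "range u \<subseteq> X" "antimono u" "\<And>v. (\<forall>n::nat. v \<le> u n) \<longleftrightarrow> v \<le> y"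
    "\<And>n v. (\<forall>m\<le>n. v \<le> a m) \<Longrightarrow> v \<le> u n"
proof -
  have "\<forall>n. \<exists>x. range x \<subseteq> X \<and> (\<forall>v. (\<forall>k::nat. v \<le> x k) \<longleftrightarrow> v \<le> a n)"
    using a subspace_X by (intro allI adherence_above) auto
  then obtain f where f: "\<And>n. range (f n) \<subseteq> X"
    "\<And>n v. (\<forall>k::nat. v \<le> f n k) \<longleftrightarrow> v \<le> a n" by metis
  define g where "g j = f (fst (prod_decode j)) (snd (prod_decode j))" for j
  have g: "range g \<subseteq> X" using f(1) unfolding g_def by blast
  obtain u where u: "range u \<subseteq> X" "antimono u" "\<And>n v. v \<le> u n \<longleftrightarrow> (\<forall>m\<le>n. v \<le> g m)"
    using sublattice_running_inf[OF sublattice g] by blast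
  have "(\<forall>n. v \<le> u n) \<longleftrightarrow> (\<forall>j. v \<le> g j)" for v
    unfolding u(3) by blast
  moreover have "(\<forall>j. v \<le> g j) \<longleftrightarrow> (\<forall>n k. v \<le> f n k)" for v
    unfolding g_def by (metis fst_conv snd_conv prod_encode_inverse)
  ultimately have "(\<forall>n. v \<le> u n) \<longleftrightarrow> v \<le> y" for v
    by (simp add: f(2) y)
  moreover have "v \<le> u n" if v: "\<forall>m\<le>n. v \<le> a m" for n v
    unfolding u(3)
  proof (intro allI impI)
    fix j assume "j \<le> n"
    \<comment> \<open>The pairing function is never below its first component, so
      \<open>g 0, ..., g n\<close> involve only \<open>a m\<close> with m \<le> n.\<close>
    moreover have "fst (prod_decode j) \<le> j"
      using le_prod_encode_1[of "fst (prod_decode j)" "snd (prod_decode j)"] by simp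
    ultimately have "v \<le> a (fst (prod_decode j))" using v by simp
    then show "v \<le> g j" unfolding g_def using f(2) by blast
  qed
  ultimately show ?thesis using that u(1,2) by blast
qed

text \<open>The second hypothesis makes \<open>y\<close> the supremum of the increasing sequence
  \<open>- w\<close>. The gap \<open>u + w\<close> decreases to zero and bounds
  \<open>u - y\<close>, so a regulator of the gap serves \<open>y\<close>.\<close>

lemma mem_adherence_if_seq_inf:
  assumes "seq_inf y" "seq_inf (- y)"
  shows "y \<in> Y"
proof -
  obtain u where u: "range u \<subseteq> X" "antimono u" "\<And>v. (\<forall>n::nat. v \<le> u n) \<longleftrightarrow> v \<le> y"
    using assms(1) unfolding seq_inf_def by blast
  obtain w where w: "range w \<subseteq> X" "antimono w" "\<And>v. (\<forall>n::nat. v \<le> w n) \<longleftrightarrow> v \<le> - y"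
    using assms(2) unfolding seq_inf_def by blast
  have uy: "y \<le> u n" and wy: "- y \<le> w n" for n using u(3) w(3) by blast+
  have "decreases_to_zero X (\<lambda>n. u n + w n)"
    unfolding decreases_to_zero_def
  proof (intro conjI ballI impI allI)
    show "range (\<lambda>n. u n + w n) \<subseteq> X" using u(1) w(1) subspace_X by (auto intro: subspace_add)
    show "antimono (\<lambda>n. u n + w n)"
      using u(2) w(2) by (auto simp: antimono_def intro: add_mono)
    show "0 \<le> u n + w n" for n using add_mono[OF uy wy] by simp
    show "v \<le> 0" if v: "\<forall>n. v \<le> u n + w n" for v
    proof -
      \<comment> \<open>Monotonicity separates the indices, so that the two infima can be taken one
        after the other.\<close>
      have "v - w m \<le> u n" for m n
      proof -
        have "v \<le> u (max m n) + w (max m n)" using v by blast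
        also have "\<dots> \<le> u n + w m" using u(2) w(2) by (intro add_mono) (auto simp: antimono_def)
        finally show ?thesis by (simp add: diff_le_eq)
      qed
      then have "v - w m \<le> y" for m using u(3) by blast
      then have "v - y \<le> w m" for m by (simp add: algebra_simps)
      then have "v - y \<le> - y" using w(3) by blast
      then show ?thesis by simp
    qed
  qed
  then obtain e where e: "0 \<le> e" "\<And>\<epsilon>. \<epsilon> > 0 \<Longrightarrow> \<exists>n. u n + w n \<le> \<epsilon> *\<^sub>R e"
    using regulator by blast
  have uw: "\<bar>u n - y\<bar> \<le> u n + w n" for n
  proof -
    have "\<bar>u n - y\<bar> = u n - y" using uy by simp
    also have "\<dots> \<le> u n + w n" using add_left_mono[OF wy, of "u n" n] by simp
    finally show ?thesis .
  qed
  have "\<exists>x\<in>X. \<bar>x - y\<bar> \<le> \<epsilon> *\<^sub>R e" if \<epsilon>: "\<epsilon> > 0" for \<epsilon>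
    using e(2)[OF \<epsilon>] order_trans[OF uw] u(1) by blast
  with e(1) show ?thesis unfolding mem_uniform_adherence_iff by blast
qed

text \<open>A point adherent to \<open>Y\<close> is a countable infimum of points of
  \<open>Y\<close>, hence of points of \<open>X\<close>, and so is its negative. The possibly
  unrelated regulators of the points of \<open>Y\<close> never have to be combined; a single new one
  comes from the gap sequence.\<close>

lemma adherence_adherence: "uniform_adherence UNIV Y = Y"
proof
  have seq_inf: "seq_inf y" if y: "y \<in> uniform_adherence UNIV Y" for y
  proof -
    obtain a where a: "range a \<subseteq> Y" "\<And>v. (\<forall>n::nat. v \<le> a n) \<longleftrightarrow> v \<le> y"
      using adherence_above[OF subspace_adherence subset_uniform_adherence y] by blast
    obtain u where "range u \<subseteq> X" "antimono u" "\<And>v. (\<forall>n::nat. v \<le> u n) \<longleftrightarrow> v \<le> y"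
      by (rule adherence_seq_inf_above[OF a]) blast
    then show ?thesis unfolding seq_inf_def by blast
  qed
  show "uniform_adherence UNIV Y \<subseteq> Y"
  proof
    fix y assume y: "y \<in> uniform_adherence UNIV Y"
    then obtain e where e: "0 \<le> e" "\<And>\<epsilon>. \<epsilon> > 0 \<Longrightarrow> \<exists>x\<in>Y. \<bar>x - y\<bar> \<le> \<epsilon> *\<^sub>R e"
      unfolding mem_uniform_adherence_iff by blast
    have "\<exists>x\<in>Y. \<bar>x - - y\<bar> \<le> \<epsilon> *\<^sub>R e" if \<epsilon>: "\<epsilon> > 0" for \<epsilon>
    proof -
      obtain x where x: "x \<in> Y" "\<bar>x - y\<bar> \<le> \<epsilon> *\<^sub>R e" using e(2)[OF \<epsilon>] by blast
      have "\<bar>- x - - y\<bar> = \<bar>x - y\<bar>" by (simp add: abs_minus_commute)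
      with x show ?thesis using subspace_neg[OF subspace_adherence x(1)] by metis
    qed
    with e(1) have "- y \<in> uniform_adherence UNIV Y" unfolding mem_uniform_adherence_iff by blast
    with y show "y \<in> Y" by (intro mem_adherence_if_seq_inf seq_inf)
  qed
qed (rule subset_uniform_adherence)

lemma uniform_closure_eq: "uniform_closure UNIV X = Y"
proof
  have "uniformly_closed UNIV Y"
    by (simp add: uniformly_closed_def adherence_adherence)
  then have "Y \<in> {C. uniformly_closed UNIV C \<and> X \<subseteq> C}"
    using subset_uniform_adherence by simp
  then show "uniform_closure UNIV X \<subseteq> Y"
    unfolding uniform_closure_def by (rule Inter_lower)
  show "Y \<subseteq> uniform_closure UNIV X"
    unfolding uniform_closure_def
  proof (rule Inter_greatest)
    fix C assume "C \<in> {C. uniformly_closed UNIV C \<and> X \<subseteq> C}"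
    then show "Y \<subseteq> C"
      using uniform_adherence_mono[of X C] by (simp add: uniformly_closed_def)
  qed
qed

section \<open>Agreement of the convergences in \<open>Y\<close> and completeness of
  \<open>Y\<close>\<close>

lemma adherence_regulator:
  assumes "decreases_to_zero Y z"
  shows "\<exists>e\<in>Y. 0 \<le> e \<and> (\<forall>\<epsilon>>0. \<exists>n. z n \<le> \<epsilon> *\<^sub>R e)"
proof -
  have "decreases_to_zero UNIV z"
    using assms subset_uniform_adherence by (rule decreases_to_zero_UNIV)
  then have inf0: "(\<forall>n. v \<le> z n) \<longleftrightarrow> v \<le> 0" for v
    unfolding decreases_to_zero_def using order_trans[of v 0] by blast
  have z: "range z \<subseteq> Y" "antimono z"
    using assms by (auto simp: decreases_to_zero_def)
  obtain u where u: "range u \<subseteq> X" "antimono u" "\<And>v. (\<forall>n::nat. v \<le> u n) \<longleftrightarrow> v \<le> 0"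
    "\<And>n v. (\<forall>m\<le>n. v \<le> z m) \<Longrightarrow> v \<le> u n"
    using adherence_seq_inf_above[OF z(1) inf0] by blast
  \<comment> \<open>As \<open>z\<close> decreases, \<open>z n\<close> is a lower bound of
    \<open>z 0, ..., z n\<close>.\<close>
  have zu: "z n \<le> u n" for n using u(4) z(2) by (simp add: antimono_def)
  have "decreases_to_zero X u" using u(1-3) unfolding decreases_to_zero_def by blast
  then obtain e where e: "0 \<le> e" "\<And>\<epsilon>. \<epsilon> > 0 \<Longrightarrow> \<exists>n. u n \<le> \<epsilon> *\<^sub>R e"
    using regulator by blast
  \<comment> \<open>The regulator has to lie in \<open>Y\<close>, so it is replaced by a larger
    element of \<open>X\<close>.\<close>
  obtain e' where e': "e' \<in> X" "e \<le> e'" using majorizing by blast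
  have "\<exists>n. z n \<le> \<epsilon> *\<^sub>R e'" if \<epsilon>: "\<epsilon> > 0" for \<epsilon>
  proof -
    obtain n where "u n \<le> \<epsilon> *\<^sub>R e" using e(2)[OF \<epsilon>] by blast
    also have "\<dots> \<le> \<epsilon> *\<^sub>R e'" using \<epsilon> by (intro scaleR_left_mono e') simp
    finally show ?thesis using order_trans[OF zu] by blast
  qed
  moreover have "e' \<in> Y" using e'(1) subset_uniform_adherence by blast
  ultimately show ?thesis using order_trans[OF e(1) e'(2)] by blast
qed

text \<open>Even for a net the dominating family is a sequence, so a regulator of that sequence
  regulates the net, whatever its index set.\<close>

lemma sigma_order_conv_adherence_iff:
  "sigma_order_conv Y \<Lambda> le x l \<longleftrightarrow> uniform_conv Y \<Lambda> le x l"
proof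
  assume "sigma_order_conv Y \<Lambda> le x l"
  then obtain z where z: "decreases_to_zero Y z"
    "\<And>n. \<exists>\<alpha>0\<in>\<Lambda>. \<forall>\<alpha>\<in>\<Lambda>. le \<alpha>0 \<alpha> \<longrightarrow> \<bar>x \<alpha> - l\<bar> \<le> z n"
    unfolding sigma_order_conv_def by blast
  obtain e where e: "e \<in> Y" "0 \<le> e" "\<And>\<epsilon>. \<epsilon> > 0 \<Longrightarrow> \<exists>n. z n \<le> \<epsilon> *\<^sub>R e"
    using adherence_regulator[OF z(1)] by blast
  have "\<exists>\<alpha>0\<in>\<Lambda>. \<forall>\<alpha>\<in>\<Lambda>. le \<alpha>0 \<alpha> \<longrightarrow> \<bar>x \<alpha> - l\<bar> \<le> \<epsilon> *\<^sub>R e" if \<epsilon>: "\<epsilon> > 0" for \<epsilon>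
  proof -
    obtain n where n: "z n \<le> \<epsilon> *\<^sub>R e" using e(3)[OF \<epsilon>] by blast
    show ?thesis using z(2)[of n] order_trans[OF _ n] by blast
  qed
  with e(1,2) show "uniform_conv Y \<Lambda> le x l" unfolding uniform_conv_def by blast
qed (rule uniform_conv_imp_sigma_order_conv[OF subspace_adherence])

lemma uniformly_complete_adherence: "uniformly_complete Y"
  unfolding uniformly_complete_def
proof (intro allI impI)
  fix \<Lambda> :: "'d net_index set" and le x
  assume net: "net_in Y \<Lambda> le x" and cauchy: "uniformly_cauchy Y \<Lambda> le x"
  obtain l where l: "uniform_conv Y \<Lambda> le x l"
    using uniformly_cauchy_imp_uniform_conv[OF net cauchy] ..
  have "l \<in> uniform_adherence UNIV Y"
    by (rule uniform_adherenceI[OF net uniform_conv_mono[OF l subset_UNIV] UNIV_I])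
  then have "l \<in> Y" by (simp only: adherence_adherence)
  with l show "\<exists>l\<in>Y. uniform_conv Y \<Lambda> le x l" ..
qed

text \<open>The equivalence also applies to the product index sets of Cauchy nets, so both kinds of
  completeness of \<open>Y\<close> unfold to the same statement.\<close>

lemma sigma_order_complete_adherence: "sigma_order_complete Y"
  using uniformly_complete_adherence
  unfolding uniformly_complete_def sigma_order_complete_def uniformly_cauchy_def
    sigma_order_cauchy_def sigma_order_conv_adherence_iff .

section \<open>Minimality of \<open>Y\<close> among the complete sublattices\<close>

lemma sigma_order_limit_unique:
  assumes S: "sublattice S" "X \<subseteq> S"
    and l: "sigma_order_conv S (UNIV :: nat set) (\<le>) x l"
    and y: "\<And>n. \<bar>x n - y\<bar> \<le> (1 / real (Suc n)) *\<^sub>R e" "0 \<le> e"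
  shows "l = y"
proof -
  obtain z where z: "decreases_to_zero S z" "\<And>n. \<exists>N. \<forall>k\<ge>N. \<bar>x k - l\<bar> \<le> z n"
    using l unfolding sigma_order_conv_def by auto
  have "\<bar>l - y\<bar> \<le> z n" for n
  proof (rule dedekind_le_if_le_add_scaleR)
    fix m
    obtain N where N: "\<And>k. k \<ge> N \<Longrightarrow> \<bar>x k - l\<bar> \<le> z n" using z(2) by blast
    define k where "k = max N m"
    have "\<bar>l - y\<bar> \<le> \<bar>x k - l\<bar> + \<bar>x k - y\<bar>"
      using abs_triangle_ineq[of "l - x k" "x k - y"] by (simp add: abs_minus_commute)
    also have "\<dots> \<le> z n + (1 / real (Suc k)) *\<^sub>R e"
      using N y(1) by (intro add_mono) (auto simp: k_def)
    also have "\<dots> \<le> z n + (1 / real (Suc m)) *\<^sub>R e"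
      using y(2) by (intro add_left_mono scaleR_right_mono divide_left_mono) (auto simp: k_def)
    finally show "\<bar>l - y\<bar> \<le> z n + (1 / real (Suc m)) *\<^sub>R e" .
  qed simp
  \<comment> \<open>Since \<open>y\<close> is not known to lie in \<open>S\<close>, the infimum of
    \<open>z\<close> must be zero in the whole space.\<close>
  then have "\<bar>l - y\<bar> \<le> 0"
    using decreases_to_zero_UNIV[OF z(1) S(2)] unfolding decreases_to_zero_def by blast
  then show ?thesis by simp
qed

text \<open>A sequence of \<open>X\<close> tending to \<open>y\<close> with a regulator in
  \<open>X\<close> is Cauchy in every such \<open>S\<close>. Its limit in \<open>S\<close>, in
  either sense a \<sigma>-order limit, can only be \<open>y\<close>.\<close>

lemma adherence_subset_if_complete:
  assumes S: "sublattice S" "X \<subseteq> S" and complete: "uniformly_complete S \<or> sigma_order_complete S"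
  shows "Y \<subseteq> S"
proof
  fix y assume "y \<in> Y"
  then obtain f where f: "\<And>\<epsilon>. \<epsilon> > 0 \<Longrightarrow> \<exists>x\<in>X. \<bar>x - y\<bar> \<le> \<epsilon> *\<^sub>R f"
    unfolding mem_uniform_adherence_iff by blast
  obtain e where e: "e \<in> X" "0 \<le> e" "f \<le> e" using majorizing_nonneg by blast
  define d where "d n = (1 / real (Suc n)) *\<^sub>R e" for n
  have "\<exists>x\<in>X. \<bar>x - y\<bar> \<le> d n" for n
  proof -
    have "(1 / real (Suc n)) *\<^sub>R f \<le> d n"
      unfolding d_def using e by (intro scaleR_left_mono) auto
    moreover obtain x where "x \<in> X" "\<bar>x - y\<bar> \<le> (1 / real (Suc n)) *\<^sub>R f"
      using f[of "1 / real (Suc n)"] by auto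
    ultimately show ?thesis using order_trans by blast
  qed
  then obtain x where x: "\<And>n. x n \<in> X" "\<And>n. \<bar>x n - y\<bar> \<le> d n" by metis
  have net: "net_in S (UNIV :: nat set) (\<le>) x"
    using x(1) S(2) directed_set_nat by (auto simp: net_in_def)
  have "\<exists>p\<in>UNIV \<times> UNIV. \<forall>q\<in>UNIV \<times> UNIV. rel_prod (\<le>) (\<le>) p q \<longrightarrow>
      \<bar>(case q of (n, m) \<Rightarrow> x n - x m) - 0\<bar> \<le> \<epsilon> *\<^sub>R e" if \<epsilon>: "\<epsilon> > 0" for \<epsilon>
  proof -
    obtain N where N: "1 / real (Suc N) < \<epsilon> / 2"
      using \<epsilon> by (metis half_gt_zero nat_approx_posE)
    have "\<bar>x n - x m\<bar> \<le> \<epsilon> *\<^sub>R e" if nm: "N \<le> n" "N \<le> m" for n m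
    proof -
      have dN: "d k \<le> d N" if "N \<le> k" for k
        unfolding d_def using e(2) that by (intro scaleR_right_mono divide_left_mono) auto
      have "\<bar>x n - x m\<bar> \<le> \<bar>x n - y\<bar> + \<bar>x m - y\<bar>"
        using abs_triangle_ineq[of "x n - y" "y - x m"] by (simp add: abs_minus_commute)
      also have "\<dots> \<le> d N + d N"
        using x(2) dN nm by (intro add_mono) (blast intro: order_trans)+
      also have "\<dots> = (2 / real (Suc N)) *\<^sub>R e"
        unfolding d_def by (simp flip: scaleR_add_left)
      also have "\<dots> \<le> \<epsilon> *\<^sub>R e"
        using N e(2) by (intro scaleR_right_mono) (auto simp: field_simps)
      finally show ?thesis .
    qed
    then show ?thesis by (intro bexI[of _ "(N, N)"]) auto
  qed
  then have cauchy: "uniformly_cauchy S (UNIV :: nat set) (\<le>) x"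
    using e S(2) unfolding uniformly_cauchy_def uniform_conv_def by blast
  have sub: "subspace S" using S(1) by (simp add: sublattice_def)
  have "\<exists>l\<in>S. sigma_order_conv S (UNIV :: nat set) (\<le>) x l"
    using complete
  proof
    assume "uniformly_complete S"
    from uniformly_completeD[OF this net cauchy] show ?thesis
      by (elim bexE) (rule bexI, rule uniform_conv_imp_sigma_order_conv[OF sub])
  next
    assume "sigma_order_complete S"
    moreover have "sigma_order_cauchy S (UNIV :: nat set) (\<le>) x"
      using uniform_conv_imp_sigma_order_conv[OF sub cauchy[unfolded uniformly_cauchy_def]]
      unfolding sigma_order_cauchy_def .
    ultimately show ?thesis using net by (intro sigma_order_completeD)
  qed
  then obtain l where "l \<in> S" "sigma_order_conv S (UNIV :: nat set) (\<le>) x l" ..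
  with sigma_order_limit_unique[OF S this(2) x(2)[unfolded d_def] e(2)] show "y \<in> S" by simp
qed

lemma uniform_completion_eq: "uniform_completion X = Y"
  unfolding uniform_completion_def
proof (intro equalityI Inter_lower Inter_greatest)
  show "Y \<in> {S. sublattice S \<and> X \<subseteq> S \<and> uniformly_complete S}"
    by (simp add: sublattice_adherence subset_uniform_adherence uniformly_complete_adherence)
  show "Y \<subseteq> S" if "S \<in> {S. sublattice S \<and> X \<subseteq> S \<and> uniformly_complete S}" for S
    using that by (simp add: adherence_subset_if_complete)
qed

lemma sigma_order_completion_eq:
  "\<Inter>{S. sublattice S \<and> X \<subseteq> S \<and> sigma_order_complete S} = Y"
proof (intro equalityI Inter_lower Inter_greatest)
  show "Y \<in> {S. sublattice S \<and> X \<subseteq> S \<and> sigma_order_complete S}"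
    by (simp add: sublattice_adherence subset_uniform_adherence sigma_order_complete_adherence)
  show "Y \<subseteq> S" if "S \<in> {S. sublattice S \<and> X \<subseteq> S \<and> sigma_order_complete S}" for S
    using that by (simp add: adherence_subset_if_complete)
qed

end

section \<open>Transfer along the embedding and conclusion\<close>

lemma regulated_sublattice_order_completion:
  fixes \<iota> :: "'a::archimedean_vector_lattice \<Rightarrow> 'd::dedekind_complete_vector_lattice"
  assumes \<iota>: "order_completion \<iota>"
    and agree: "convergences_agree (UNIV :: 'a set) (UNIV :: nat set) (\<le>)"
  shows "regulated_sublattice (range \<iota>)"
proof
  have lin: "linear \<iota>" and inj: "inj \<iota>" and sup: "\<And>x y. \<iota> (sup x y) = sup (\<iota> x) (\<iota> y)"
    and dense: "\<And>y. y > 0 \<Longrightarrow> \<exists>x. 0 < \<iota> x \<and> \<iota> x \<le> y" and maj: "\<And>y. \<exists>x. y \<le> \<iota> x"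
    using \<iota> unfolding order_completion_def by blast+
  \<comment> \<open>An injective map preserving suprema reflects the order, because x \<le> y means
    \<open>sup x y = y\<close>.\<close>
  have le: "\<iota> x \<le> \<iota> y \<longleftrightarrow> x \<le> y" for x y
    using inj sup by (metis inj_eq le_iff_sup)
  show "sublattice (range \<iota>)"
    unfolding sublattice_def
    using linear_subspace_image[OF lin subspace_UNIV] by (auto simp flip: sup)
  show "\<exists>x\<in>range \<iota>. 0 < x \<and> x \<le> y" if "y > 0" for y using dense[OF that] by blast
  show "\<exists>x\<in>range \<iota>. y \<le> x" for y using maj by blast
  fix z :: "nat \<Rightarrow> 'd" assume z: "decreases_to_zero (range \<iota>) z"
  then have "\<forall>n. \<exists>x. z n = \<iota> x" unfolding decreases_to_zero_def by blast
  then obtain w where w: "\<And>n. z n = \<iota> (w n)" by metis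
  have nonneg: "0 \<le> \<iota> x \<longleftrightarrow> 0 \<le> x" "\<iota> x \<le> 0 \<longleftrightarrow> x \<le> 0" for x
    using le[of 0 x] le[of x 0] linear_0[OF lin] by simp_all
  have w0: "decreases_to_zero UNIV w"
    using z unfolding decreases_to_zero_def antimono_def by (simp add: w le nonneg)
  then have pos: "\<And>n. \<bar>w n\<bar> = w n" unfolding decreases_to_zero_def by simp
  \<comment> \<open>A decreasing sequence with infimum zero serves as its own dominating
    sequence.\<close>
  have "sigma_order_conv UNIV (UNIV :: nat set) (\<le>) w 0"
    unfolding sigma_order_conv_def
    using w0 by (intro exI[of _ w]) (auto simp: pos decreases_to_zero_def antimono_def)
  then have "uniform_conv UNIV (UNIV :: nat set) (\<le>) w 0"
    using agree unfolding convergences_agree_def by blast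
  then obtain e where e: "0 \<le> e" "\<And>\<epsilon>. \<epsilon> > 0 \<Longrightarrow> \<exists>N. \<forall>n\<ge>N. w n \<le> \<epsilon> *\<^sub>R e"
    unfolding uniform_conv_def by (auto simp: pos)
  then have "\<exists>n. z n \<le> \<epsilon> *\<^sub>R \<iota> e" if \<epsilon>: "\<epsilon> > 0" for \<epsilon>
    using e(2)[OF \<epsilon>] by (auto simp: w le simp flip: linear_scale[OF lin])
  then show "\<exists>e\<ge>0. \<forall>\<epsilon>>0. \<exists>n. z n \<le> \<epsilon> *\<^sub>R e" using e(1) nonneg by blast
qed

theorem theorem8p4:
  fixes \<iota> :: "'a::archimedean_vector_lattice \<Rightarrow> 'd::dedekind_complete_vector_lattice"
  assumes "order_completion \<iota>"
    and "convergences_agree (UNIV :: 'a set) (UNIV :: nat set) (\<le>)"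
  shows "(\<forall>(\<Lambda> :: 'i set) le. directed_set \<Lambda> le \<longrightarrow>
            convergences_agree (uniform_completion (range \<iota>)) \<Lambda> le) \<and>
         uniform_adherence UNIV (range \<iota>) = uniform_closure UNIV (range \<iota>) \<and>
         uniform_closure UNIV (range \<iota>) =
           \<Inter>{S. sublattice S \<and> range \<iota> \<subseteq> S \<and> sigma_order_complete S}"
proof -
  interpret regulated_sublattice "range \<iota>"
    using assms by (rule regulated_sublattice_order_completion)
  have "convergences_agree Y \<Lambda> le" for \<Lambda> :: "'i set" and le
    unfolding convergences_agree_def sigma_order_conv_adherence_iff by simp
  then show ?thesis
    unfolding uniform_completion_eq uniform_closure_eq sigma_order_completion_eq by simp
qed

end
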